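(* Let $F$ be a field with $\operatorname{char}(F)\neq 2,3$, let $K/F$ be a quadratic étale extension with non-trivial Galois automorphism $\sigma$, and denote the norm and trace of this extension by $\operatorname{Nr}$ and $\operatorname{Tr}$, respectively. Let $\mathcal{K}=(J,N,\sharp,T)$ be a hermitian cubic norm structure over $K/F$, and let $\mathcal{A}=K\oplus J$ be the structurable $F$-algebra of skew-dimension one with involution $\overline{(s,b)}:=(s^\sigma,b)$ and multiplication $$(s,b)(t,c):=\bigl(st+T(b,c),\; sc+t^\sigma b+b\times c\bigr)$$ for $s,t\in K$, $b,c\in J$. Then the norm $\nu$ of $\mathcal{A}$ is given by $$\nu(s,b)=\bigl(\operatorname{Nr}(s)-T(b,b)\bigr)^2-4\,T(b^\sharp,b^\sharp)+4\operatorname{Tr}\bigl(sN(b)\bigr)$$ for all $(s,b)\in\mathcal{A}$.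
   Context: **Conventions.** A quadratic étale extension $K/F$ is either a separable quadratic field extension or the split algebra $F\oplus F$ (with $\sigma$ the exchange map). For $t\in K$ write $t^\sigma=\sigma(t)$, $t^{2\sigma}=(t^\sigma)^2$; $\operatorname{Nr}(t)=tt^\sigma$, $\operatorname{Tr}(t)=t+t^\sigma$. **Hermitian cubic norm structure.** A hermitian (non-unital) cubic norm structure over $K/F$ is a quadruple $\mathcal{K}=(J,N,\sharp,T)$, where $J$ is a left $K$-module, $N\colon J\to K$ is a non-zero map, $\sharp\colon J\to J$, $a\mapsto a^\sharp$, is a map, and $T\colon J\times J\to K$ is a hermitian form (biadditive, $T(sa,tb)=st^\sigma T(a,b)$ and $T(a,b)^\sigma=T(b,a)$), such that with $a\times b:=(a+b)^\sharp-a^\sharp-b^\sharp$, for all $t\in K$, $a,b\in J$: (i) $(ta)^\sharp=t^{2\sigma}a^\sharp$; (ii) $N(ta)=t^3N(a)$; (iii) $N(a+b)=N(a)+T(b,a^\sharp)+T(a,b^\sharp)+N(b)$; (iv) $a^{\sharp\sharp}=N(a)a$. **Norm of a structurable algebra of skew-dimension one.** Let $\mathcal{A}$ be a structurable $F$-algebra with involution $x\mapsto\overline{x}$ and with one-dimensional space $\mathcal{S}=\{x:\overline{x}=-x\}$ of skew elements. Fix any non-zero $s_0\in\mathcal{S}$ and let $\mu\in F^\times$ be such that $s_0^2=\mu\cdot 1$ (such $\mu$ exists for the algebras considered here). For $x,y\in\mathcal{A}$ put $U_x(y):=2(x\overline{y})x-(x\overline{x})y$ and $\psi(x,y):=x\overline{y}-y\overline{x}\in\mathcal{S}$.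 The norm of $\mathcal{A}$ is the map $\nu\colon\mathcal{A}\to F$ given by $$\nu(x)=\tfrac{1}{6\mu}\,\psi\bigl(x,U_x(s_0x)\bigr)\,s_0\in F\cdot 1=F ,$$ which does not depend on the choice of $s_0$. *)

theory Defs
  imports "HOL-Computational_Algebra.Computational_Algebra" "HOL-Library.Product_Plus"
begin

section \<open>Quadratic etale extensions\<close>

text \<open>
  An \<open>F\<close>-algebra structure on \<open>K\<close> is given by its structure map \<open>\<iota> : F \<rightarrow> K\<close>, so that scalar
  multiplication is \<open>\<iota> c * x\<close>.  The split algebra has zero divisors, hence \<open>K\<close> is only a
  commutative ring.
\<close>

definition algebra_map :: "('f::field \<Rightarrow> 'k::comm_ring_1) \<Rightarrow> bool" where
  "algebra_map \<iota> \<longleftrightarrow> \<iota> 1 = 1 \<and> (\<forall>a b. \<iota> (a + b) = \<iota> a + \<iota> b) \<and> (\<forall>a b. \<iota> (a * b) = \<iota> a * \<iota> b)"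

text \<open>Algebraic over the base field with separable minimal polynomial.\<close>

definition separable_element :: "('f::field \<Rightarrow> 'k::comm_ring_1) \<Rightarrow> 'k \<Rightarrow> bool" where
  "separable_element \<iota> x \<longleftrightarrow>
     (\<exists>p. irreducible p \<and> poly (map_poly \<iota> p) x = 0 \<and> coprime p (pderiv p))"

definition separable_quadratic_field_extension :: "('f::field \<Rightarrow> 'k::comm_ring_1) \<Rightarrow> bool" where
  "separable_quadratic_field_extension \<iota> \<longleftrightarrow>
     algebra_map \<iota> \<and> (\<forall>x :: 'k. x \<noteq> 0 \<longrightarrow> (\<exists>y. x * y = 1)) \<and>
     vector_space.dim (\<lambda>c x. \<iota> c * x) (UNIV :: 'k set) = 2 \<and> (\<forall>x. separable_element \<iota> x)"

definition nontrivial_galois_automorphism :: "('f::field \<Rightarrow> 'k::comm_ring_1) \<Rightarrow> ('k \<Rightarrow> 'k) \<Rightarrow> bool" where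
  "nontrivial_galois_automorphism \<iota> \<sigma> \<longleftrightarrow>
     bij \<sigma> \<and> (\<forall>x y. \<sigma> (x + y) = \<sigma> x + \<sigma> y) \<and> (\<forall>x y. \<sigma> (x * y) = \<sigma> x * \<sigma> y) \<and>
     (\<forall>c. \<sigma> (\<iota> c) = \<iota> c) \<and> \<sigma> \<noteq> id"

text \<open>
  \<open>\<phi>\<close> is an isomorphism of \<open>F\<close>-algebras from \<open>K\<close> onto \<open>F \<oplus> F\<close> (with componentwise operations and
  diagonal structure map) which carries \<open>\<sigma>\<close> to the exchange map.
\<close>

definition split_quadratic_algebra :: "('f::field \<Rightarrow> 'k::comm_ring_1) \<Rightarrow> ('k \<Rightarrow> 'k) \<Rightarrow> bool" where
  "split_quadratic_algebra \<iota> \<sigma> \<longleftrightarrow>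
     (\<exists>\<phi> :: 'k \<Rightarrow> 'f \<times> 'f. bij \<phi> \<and>
        (\<forall>x y. \<phi> (x + y) = (fst (\<phi> x) + fst (\<phi> y), snd (\<phi> x) + snd (\<phi> y))) \<and>
        (\<forall>x y. \<phi> (x * y) = (fst (\<phi> x) * fst (\<phi> y), snd (\<phi> x) * snd (\<phi> y))) \<and>
        (\<forall>c. \<phi> (\<iota> c) = (c, c)) \<and>
        (\<forall>x. \<phi> (\<sigma> x) = (snd (\<phi> x), fst (\<phi> x))))"

definition quadratic_etale :: "('f::field \<Rightarrow> 'k::comm_ring_1) \<Rightarrow> ('k \<Rightarrow> 'k) \<Rightarrow> bool" where
  "quadratic_etale \<iota> \<sigma> \<longleftrightarrow>
     separable_quadratic_field_extension \<iota> \<and> nontrivial_galois_automorphism \<iota> \<sigma> \<or>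
     split_quadratic_algebra \<iota> \<sigma>"

text \<open>
  Norm and trace of \<open>K/F\<close>, as elements of \<open>K\<close>; they lie in the image of \<open>F\<close>.
\<close>

definition Nr :: "('k::comm_ring_1 \<Rightarrow> 'k) \<Rightarrow> 'k \<Rightarrow> 'k" where
  "Nr \<sigma> t = t * \<sigma> t"

definition Tr :: "('k::comm_ring_1 \<Rightarrow> 'k) \<Rightarrow> 'k \<Rightarrow> 'k" where
  "Tr \<sigma> t = t + \<sigma> t"


section \<open>Hermitian cubic norm structures\<close>

definition cross :: "('j::ab_group_add \<Rightarrow> 'j) \<Rightarrow> 'j \<Rightarrow> 'j \<Rightarrow> 'j" where
  "cross sharp a b = sharp (a + b) - sharp a - sharp b"

locale hermitian_cubic_norm_structure = module scale
  for scale :: "'k::comm_ring_1 \<Rightarrow> 'j::ab_group_add \<Rightarrow> 'j" +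
  fixes \<iota> :: "'f::field \<Rightarrow> 'k" and \<sigma> :: "'k \<Rightarrow> 'k"
    and N :: "'j \<Rightarrow> 'k" and sharp :: "'j \<Rightarrow> 'j" and T :: "'j \<Rightarrow> 'j \<Rightarrow> 'k"
  assumes etale: "quadratic_etale \<iota> \<sigma>"
    and N_nonzero: "\<exists>a. N a \<noteq> 0"
    and T_add_left: "T (a + a') b = T a b + T a' b"
    and T_add_right: "T a (b + b') = T a b + T a b'"
    and T_sesquilinear: "T (scale s a) (scale t b) = s * \<sigma> t * T a b"
    and T_hermitian: "\<sigma> (T a b) = T b a"
    and sharp_scale: "sharp (scale t a) = scale ((\<sigma> t)\<^sup>2) (sharp a)"
    and N_scale: "N (scale t a) = t ^ 3 * N a"
    and N_add: "N (a + b) = N a + T b (sharp a) + T a (sharp b) + N b"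
    and sharp_sharp: "sharp (sharp a) = scale (N a) a"


section \<open>Structurable algebras of skew-dimension one and their norm\<close>

text \<open>
  The operations derived from a multiplication and an involution are defined before any axioms are
  imposed, so that their defining equations hold unconditionally.
\<close>

locale involution_operations =
  fixes smult :: "'f::field \<Rightarrow> 'a::ab_group_add \<Rightarrow> 'a"
    and mul :: "'a \<Rightarrow> 'a \<Rightarrow> 'a" and one :: 'a and conj :: "'a \<Rightarrow> 'a"
begin

definition V :: "'a \<Rightarrow> 'a \<Rightarrow> 'a \<Rightarrow> 'a" where
  "V x y z = mul (mul x (conj y)) z + mul (mul z (conj y)) x - mul (mul z (conj x)) y"

definition U :: "'a \<Rightarrow> 'a \<Rightarrow> 'a" where
  "U x y = smult 2 (mul (mul x (conj y)) x) - mul (mul x (conj x)) y"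

definition \<psi> :: "'a \<Rightarrow> 'a \<Rightarrow> 'a" where
  "\<psi> x y = mul x (conj y) - mul y (conj x)"

definition skew :: "'a set" where
  "skew = {x. conj x = - x}"

definition skew_unit :: 'a where
  "skew_unit = (SOME s\<^sub>0. s\<^sub>0 \<in> skew \<and> s\<^sub>0 \<noteq> 0)"

definition skew_square :: 'f where
  "skew_square = (THE \<mu>. mul skew_unit skew_unit = smult \<mu> one)"

text \<open>
  \<open>skew_unit\<close> and \<open>skew_square\<close> are the elements \<open>s\<^sub>0\<close> and \<open>\<mu>\<close>.  The identification \<open>F \<cdot> 1 = F\<close> is
  made by taking the coefficient of \<open>one\<close>.
\<close>

definition norm :: "'a \<Rightarrow> 'f" where
  "norm x = (THE c. smult c one =
     smult (1 / (6 * skew_square)) (mul (\<psi> x (U x (mul skew_unit x))) skew_unit))"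

end

locale structurable_algebra = involution_operations smult mul one conj + vector_space smult
  for smult :: "'f::field \<Rightarrow> 'a::ab_group_add \<Rightarrow> 'a" and mul and one and conj +
  assumes mul_add_left: "mul (x + y) z = mul x z + mul y z"
    and mul_add_right: "mul x (y + z) = mul x y + mul x z"
    and mul_smult_left: "mul (smult c x) y = smult c (mul x y)"
    and mul_smult_right: "mul x (smult c y) = smult c (mul x y)"
    and one_left: "mul one x = x"
    and one_right: "mul x one = x"
    and conj_add: "conj (x + y) = conj x + conj y"
    and conj_smult: "conj (smult c x) = smult c (conj x)"
    and conj_mul: "conj (mul x y) = mul (conj y) (conj x)"
    and conj_conj: "conj (conj x) = x"
    and structurable:
      "V x y (V z w u) - V z w (V x y u) = V (V x y z) w u - V z (V y x w) u"

locale structurable_algebra_skew_dim_one = structurable_algebra +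
  assumes skew_dim_one: "dim skew = 1"


section \<open>The algebra \<open>K \<oplus> J\<close>\<close>

text \<open>
  Addition on \<open>K \<times> J\<close> is the componentwise one of \<^theory>\<open>HOL-Library.Product_Plus\<close>.
\<close>

definition KJ_smult ::
    "('f::field \<Rightarrow> 'k::comm_ring_1) \<Rightarrow> ('k \<Rightarrow> 'j::ab_group_add \<Rightarrow> 'j) \<Rightarrow> 'f \<Rightarrow> 'k \<times> 'j \<Rightarrow> 'k \<times> 'j" where
  "KJ_smult \<iota> scale c = (\<lambda>(s, b). (\<iota> c * s, scale (\<iota> c) b))"

definition KJ_mul ::
    "('k::comm_ring_1 \<Rightarrow> 'j::ab_group_add \<Rightarrow> 'j) \<Rightarrow> ('k \<Rightarrow> 'k) \<Rightarrow> ('j \<Rightarrow> 'j) \<Rightarrow> ('j \<Rightarrow> 'j \<Rightarrow> 'k)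
      \<Rightarrow> 'k \<times> 'j \<Rightarrow> 'k \<times> 'j \<Rightarrow> 'k \<times> 'j" where
  "KJ_mul scale \<sigma> sharp T = (\<lambda>(s, b) (t, c).
     (s * t + T b c, scale s c + scale (\<sigma> t) b + cross sharp b c))"

definition KJ_one :: "'k::comm_ring_1 \<times> 'j::ab_group_add" where
  "KJ_one = (1, 0)"

definition KJ_conj :: "('k \<Rightarrow> 'k) \<Rightarrow> 'k \<times> 'j \<Rightarrow> 'k \<times> 'j" where
  "KJ_conj \<sigma> = (\<lambda>(s, b). (\<sigma> s, b))"

text \<open>
  The same constant as the norm in \<^locale>\<open>structurable_algebra_skew_dim_one\<close>, taken at the
  operations of \<open>K \<oplus> J\<close>; no axiom of that locale enters its definition, so none is needed as a
  hypothesis to speak of it.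
\<close>

definition KJ_norm ::
    "('f::field \<Rightarrow> 'k::comm_ring_1) \<Rightarrow> ('k \<Rightarrow> 'k) \<Rightarrow> ('k \<Rightarrow> 'j::ab_group_add \<Rightarrow> 'j) \<Rightarrow> ('j \<Rightarrow> 'j)
      \<Rightarrow> ('j \<Rightarrow> 'j \<Rightarrow> 'k) \<Rightarrow> 'k \<times> 'j \<Rightarrow> 'f" where
  "KJ_norm \<iota> \<sigma> scale sharp T =
     involution_operations.norm
       (KJ_smult \<iota> scale) (KJ_mul scale \<sigma> sharp T) KJ_one (KJ_conj \<sigma>)"

end

theory Submission
  imports Defs
begin

text \<open>
  Expanding \<open>\<psi>(x, U\<^sub>x(s\<^sub>0x))\<close> for \<open>x = (s, b)\<close> involves products such as \<open>(\<alpha>b + \<beta>b\<^sup>\<sharp>) \<times> b\<close>.  The form \<open>T\<close>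
  may be degenerate, and then \<open>\<times>\<close> may fail to be biadditive, so these products have no closed form
  in general.  They enter the norm only after pairing with \<open>b\<close> under \<open>T\<close>, however: the \<open>J\<close>-component
  of \<open>\<psi>\<close> vanishes because \<open>\<times>\<close> is symmetric, and its \<open>K\<close>-component sees the \<open>J\<close>-component \<open>c\<close> of the
  second argument only through \<open>T(b, c)\<close>.

  Comparing the two ways to expand \<open>N(a + b + c)\<close> yields \<open>T(c, a \<times> b) = T(a, b \<times> c)\<close>
  (\<open>T_cross_cyclic\<close>), and therefore \<open>T(b, v \<times> tb) = 2t T(v, b\<^sup>\<sharp>)\<close>.  With \<open>T(b, b\<^sup>\<sharp>) = 3N(b)\<close> this
  expresses everything in terms of \<open>s\<close>, \<open>N(b)\<close>, \<open>T(b, b)\<close>, \<open>T(b\<^sup>\<sharp>, b\<^sup>\<sharp>)\<close>, their conjugates and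
  \<open>s\<^sub>0\<close> (\<open>psi_U_skew\<close>).

  On the side of \<open>K\<close>, the argument uses only that \<open>\<sigma>\<close> is an involution with fixed ring \<open>F\<close> and that
  there are nonzero skew elements, none of which has square zero.  Then \<open>s\<^sub>0\<^sup>2\<close> is a nonzero scalar
  \<open>\<mu>\<close>, and the right-hand side of the formula, being fixed by \<open>\<sigma>\<close>, lies in \<open>F\<close>.
\<close>

section \<open>The conjugation of a quadratic etale algebra\<close>

text \<open>
  The properties shared by separable quadratic field extensions and the split algebra \<open>F \<oplus> F\<close>; the
  split case forbids asking that \<open>K\<close> have no zero divisors, but skew elements never square to zero.
\<close>

locale quadratic_conjugation =
  fixes \<iota> :: "'f::field \<Rightarrow> 'k::comm_ring_1" and \<sigma> :: "'k \<Rightarrow> 'k"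
  assumes algebra_map: "algebra_map \<iota>"
    and conj_add: "\<sigma> (x + y) = \<sigma> x + \<sigma> y"
    and conj_mult: "\<sigma> (x * y) = \<sigma> x * \<sigma> y"
    and conj_conj: "\<sigma> (\<sigma> x) = x"
    and fixed_iff: "\<sigma> x = x \<longleftrightarrow> x \<in> range \<iota>"
    and skew_exists: "\<exists>p. p \<noteq> 0 \<and> \<sigma> p = - p"
    and skew_square_nonzero: "p \<noteq> 0 \<Longrightarrow> \<sigma> p = - p \<Longrightarrow> p * p \<noteq> 0"

lemma split_quadratic_conjugation:
  fixes \<iota> :: "'f::field \<Rightarrow> 'k::comm_ring_1"
  assumes "split_quadratic_algebra \<iota> \<sigma>"
  shows "quadratic_conjugation \<iota> \<sigma>"
proof -
  obtain \<phi> :: "'k \<Rightarrow> 'f \<times> 'f" where bij: "bij \<phi>"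
    and add: "\<And>x y. \<phi> (x + y) = (fst (\<phi> x) + fst (\<phi> y), snd (\<phi> x) + snd (\<phi> y))"
    and mult: "\<And>x y. \<phi> (x * y) = (fst (\<phi> x) * fst (\<phi> y), snd (\<phi> x) * snd (\<phi> y))"
    and scalar: "\<And>c. \<phi> (\<iota> c) = (c, c)"
    and exchange: "\<And>x. \<phi> (\<sigma> x) = (snd (\<phi> x), fst (\<phi> x))"
    using assms unfolding split_quadratic_algebra_def by blast
  have eq: "x = y \<longleftrightarrow> \<phi> x = \<phi> y" for x y
    using bij by (auto simp: bij_def inj_eq)
  have surj: "\<exists>x. \<phi> x = z" for z
    using bij by (metis bij_pointE)
  have zero: "\<phi> 0 = (0, 0)"
    using add[of 0 0] by (metis add.right_neutral add_left_imp_eq fst_conv snd_conv prod.collapse)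
  have minus: "\<phi> (- x) = (- fst (\<phi> x), - snd (\<phi> x))" for x
    using add[of x "- x"] zero by (simp add: prod_eq_iff eq_neg_iff_add_eq_0 add.commute)
  have one: "\<phi> 1 = (1, 1)"
  proof -
    obtain e where "\<phi> e = (1, 1)" using surj by blast
    then show ?thesis using mult[of e 1] by (simp add: prod_eq_iff)
  qed
  show ?thesis
  proof
    show "algebra_map \<iota>"
      unfolding algebra_map_def by (simp add: eq add mult scalar one)
    show "\<sigma> (x + y) = \<sigma> x + \<sigma> y" "\<sigma> (x * y) = \<sigma> x * \<sigma> y" "\<sigma> (\<sigma> x) = x" for x y
      by (simp_all add: eq add mult exchange)
    show "\<sigma> x = x \<longleftrightarrow> x \<in> range \<iota>" for x
      by (auto simp: eq exchange scalar image_iff prod_eq_iff)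
    obtain p where "\<phi> p = (1, -1)" using surj by blast
    then show "\<exists>p. p \<noteq> 0 \<and> \<sigma> p = - p"
      by (intro exI[of _ p]) (simp add: eq zero exchange minus)
    show "p * p \<noteq> 0" if "p \<noteq> 0" "\<sigma> p = - p" for p
    proof -
      have "snd (\<phi> p) = - fst (\<phi> p)"
        using that(2) exchange[of p] minus[of p] by simp
      then show ?thesis using that(1) by (simp add: eq zero mult prod_eq_iff)
    qed
  qed
qed

lemma dim_two_generated_by_nonscalar:
  fixes \<iota> :: "'f::field \<Rightarrow> 'k::comm_ring_1"
  assumes alg: "algebra_map \<iota>"
    and dim: "vector_space.dim (\<lambda>c x. \<iota> c * x) (UNIV :: 'k set) = 2"
    and x: "x \<notin> range \<iota>"
  shows "\<exists>a b. y = \<iota> a + \<iota> b * x"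
proof -
  interpret vs: vector_space "\<lambda>c x. \<iota> c * x"
    using alg by unfold_locales (auto simp: algebra_map_def algebra_simps)
  obtain B where B: "vs.independent B" "UNIV \<subseteq> vs.span B" "card B = 2"
    using vs.basis_exists[of UNIV] dim by metis
  then have fin: "finite B" using card.infinite by fastforce
  have "x \<notin> vs.span {1}"
    using x by (auto simp: vs.span_singleton)
  then have indep: "vs.independent {x, 1}" and "x \<noteq> 1"
    by (auto simp: vs.independent_insert vs.span_base)
  have "y \<in> vs.span {x, 1}"
  proof (rule ccontr)
    assume y: "y \<notin> vs.span {x, 1}"
    then have "vs.independent {y, x, 1}"
      using indep by (simp add: vs.independent_insert)
    then have "card {y, x, 1} \<le> card B"
      using vs.independent_span_bound[OF fin] B by blast
    moreover have "y \<noteq> x" "y \<noteq> 1" using y by (auto simp: vs.span_base)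
    ultimately show False using B \<open>x \<noteq> 1\<close> by simp
  qed
  then obtain b a where "y - \<iota> b * x = \<iota> a"
    by (auto simp: vs.span_insert vs.span_singleton)
  then show ?thesis by (intro exI[of _ a] exI[of _ b]) (simp add: algebra_simps)
qed

text \<open>
  A generator \<open>x\<close> moved by \<open>\<sigma>\<close> satisfies a quadratic equation \<open>x\<^sup>2 = \<alpha>x + \<beta>\<close> over \<open>F\<close>; its conjugate
  is another root, hence \<open>\<alpha> - x\<close>.  So \<open>\<sigma>\<close> swaps the two roots and has order two.
\<close>

lemma field_quadratic_conjugation:
  fixes \<iota> :: "'f::field \<Rightarrow> 'k::comm_ring_1"
  assumes ext: "separable_quadratic_field_extension \<iota>"
    and gal: "nontrivial_galois_automorphism \<iota> \<sigma>"
  shows "quadratic_conjugation \<iota> \<sigma>"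
proof -
  have alg: "algebra_map \<iota>"
    and inv: "\<And>x :: 'k. x \<noteq> 0 \<Longrightarrow> \<exists>y. x * y = 1"
    and dim: "vector_space.dim (\<lambda>c x. \<iota> c * x) (UNIV :: 'k set) = 2"
    using ext by (auto simp: separable_quadratic_field_extension_def)
  have add: "\<And>x y. \<sigma> (x + y) = \<sigma> x + \<sigma> y"
    and mult: "\<And>x y. \<sigma> (x * y) = \<sigma> x * \<sigma> y"
    and scalar: "\<And>c. \<sigma> (\<iota> c) = \<iota> c" and "\<sigma> \<noteq> id"
    using gal by (auto simp: nontrivial_galois_automorphism_def)
  then obtain x where x: "\<sigma> x \<noteq> x" by (auto simp: fun_eq_iff)
  then have "x \<notin> range \<iota>" using scalar by auto
  note generated = dim_two_generated_by_nonscalar[OF alg dim this]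
  have cancel: "v = 0" if uv: "u * v = 0" "u \<noteq> 0" for u v :: 'k
  proof -
    obtain w where "u * w = 1" using inv[OF uv(2)] by blast
    then have "v = w * (u * v)" by (metis mult.assoc mult.commute mult_1_left)
    then show ?thesis using uv by simp
  qed
  obtain \<beta> \<alpha> where root: "x * x = \<iota> \<beta> + \<iota> \<alpha> * x"
    using generated by blast
  have root': "\<sigma> x * \<sigma> x = \<iota> \<beta> + \<iota> \<alpha> * \<sigma> x"
    using arg_cong[OF root, of \<sigma>] by (simp add: add mult scalar)
  have "(\<sigma> x - x) * (\<sigma> x + x - \<iota> \<alpha>) = (\<sigma> x * \<sigma> x - \<iota> \<alpha> * \<sigma> x) - (x * x - \<iota> \<alpha> * x)"
    by (simp add: algebra_simps)
  also have "\<dots> = 0"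
    by (simp add: root root')
  finally have "\<sigma> x + x - \<iota> \<alpha> = 0"
    using cancel x by (metis right_minus_eq)
  then have conj_x: "\<sigma> x = \<iota> \<alpha> - x"
    by (simp add: algebra_simps)
  have conj_conj_x: "\<sigma> (\<sigma> x) = x"
  proof -
    have "\<sigma> x + x = \<iota> \<alpha>" using conj_x by simp
    then have "\<sigma> (\<sigma> x) + \<sigma> x = x + \<sigma> x"
      using add[of "\<sigma> x" x] by (simp add: scalar add.commute)
    then show ?thesis by simp
  qed
  have conj_conj: "\<sigma> (\<sigma> y) = y" for y
    using generated[of y] by (auto simp: add mult scalar conj_conj_x)
  have minus: "\<sigma> (- y) = - \<sigma> y" for y
    using add[of y "- y"] add[of 0 0] by (simp add: eq_neg_iff_add_eq_0 add.commute)
  show ?thesis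
  proof
    show "algebra_map \<iota>" by (fact alg)
    show "\<sigma> (y + z) = \<sigma> y + \<sigma> z" "\<sigma> (y * z) = \<sigma> y * \<sigma> z" "\<sigma> (\<sigma> y) = y" for y z
      by (fact add mult conj_conj)+
    show "\<sigma> y = y \<longleftrightarrow> y \<in> range \<iota>" for y
    proof
      assume fixed: "\<sigma> y = y"
      obtain a b where y: "y = \<iota> a + \<iota> b * x" using generated by blast
      then have "(\<sigma> x - x) * \<iota> b = 0"
        using fixed by (simp add: add mult scalar algebra_simps)
      then have "\<iota> b = 0" using cancel x by fastforce
      then show "y \<in> range \<iota>" using y by simp
    qed (use scalar in auto)
    show "\<exists>p. p \<noteq> 0 \<and> \<sigma> p = - p"
    proof (intro exI conjI)
      show "x - \<sigma> x \<noteq> 0" using x by simp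
      show "\<sigma> (x - \<sigma> x) = - (x - \<sigma> x)"
        using add[of x "- \<sigma> x"] by (simp add: minus conj_conj)
    qed
    show "p * p \<noteq> 0" if "p \<noteq> 0" for p :: 'k
      using cancel[of p p] that by blast
  qed
qed

lemma quadratic_etale_conjugation:
  "quadratic_etale \<iota> \<sigma> \<Longrightarrow> quadratic_conjugation \<iota> \<sigma>"
  unfolding quadratic_etale_def
  using split_quadratic_conjugation field_quadratic_conjugation by blast

context quadratic_conjugation
begin

lemma algebra_map_simps [simp]:
  "\<iota> 1 = 1" "\<iota> (a + b) = \<iota> a + \<iota> b" "\<iota> (a * b) = \<iota> a * \<iota> b"
  using algebra_map by (auto simp: algebra_map_def)

lemma algebra_map_zero [simp]: "\<iota> 0 = 0"
  using algebra_map_simps(2)[of 0 0] by simp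

lemma algebra_map_of_nat [simp]: "\<iota> (of_nat n) = of_nat n"
  by (induction n) simp_all

lemma algebra_map_numeral [simp]: "\<iota> (numeral n) = numeral n"
  using algebra_map_of_nat[of "numeral n"] by simp

lemma algebra_map_inverse: "a \<noteq> 0 \<Longrightarrow> \<iota> (inverse a) * \<iota> a = 1"
  by (metis algebra_map_simps(1,3) left_inverse)

lemma algebra_map_cancel:
  assumes "a \<noteq> 0" "\<iota> a * x = \<iota> a * y" shows "x = y"
proof -
  have "\<iota> (inverse a) * \<iota> a * x = \<iota> (inverse a) * \<iota> a * y"
    using assms(2) by (simp add: mult.assoc)
  then show ?thesis using assms(1) by (simp add: algebra_map_inverse)
qed

lemma algebra_map_eq_iff [simp]: "\<iota> a = \<iota> b \<longleftrightarrow> a = b"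
proof
  assume eq: "\<iota> a = \<iota> b"
  have "\<iota> (a - b) = 0"
    using algebra_map_simps(2)[of "a - b" b] eq by simp
  then show "a = b" using algebra_map_inverse[of "a - b"] by fastforce
qed simp

lemma conj_algebra_map [simp]: "\<sigma> (\<iota> c) = \<iota> c"
  using fixed_iff by blast

lemma conj_numeral [simp]: "\<sigma> (numeral n) = numeral n"
  using conj_algebra_map[of "numeral n"] by (simp del: conj_algebra_map)

lemma conj_one [simp]: "\<sigma> 1 = 1"
  using conj_algebra_map[of 1] by (simp del: conj_algebra_map)

lemma conj_zero [simp]: "\<sigma> 0 = 0"
  using conj_algebra_map[of 0] by (simp del: conj_algebra_map)

lemma conj_minus [simp]: "\<sigma> (- x) = - \<sigma> x"
  using conj_add[of x "- x"] by (simp add: eq_neg_iff_add_eq_0 add.commute)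

lemma conj_diff: "\<sigma> (x - y) = \<sigma> x - \<sigma> y"
  using conj_add[of x "- y"] by simp

lemma conj_power: "\<sigma> (x ^ n) = \<sigma> x ^ n"
  by (induction n) (simp_all add: conj_mult)

lemmas conj_simps [simp] = conj_add conj_diff conj_mult conj_power conj_conj

lemma skew_square_scalar:
  assumes "p \<noteq> 0" "\<sigma> p = - p"
  obtains \<mu> where "\<mu> \<noteq> 0" "p * p = \<iota> \<mu>"
proof -
  have "\<sigma> (p * p) = p * p" using assms by simp
  then obtain \<mu> where \<mu>: "p * p = \<iota> \<mu>" using fixed_iff by blast
  moreover have "\<mu> \<noteq> 0" using skew_square_nonzero[OF assms] \<mu> by auto
  ultimately show ?thesis using that by blast
qed

end


section \<open>Identities in a hermitian cubic norm structure\<close>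

sublocale hermitian_cubic_norm_structure \<subseteq> quadratic_conjugation \<iota> \<sigma>
  by (rule quadratic_etale_conjugation[OF etale])

context hermitian_cubic_norm_structure
begin

lemma T_scale_left: "T (scale t a) b = t * T a b"
  using T_sesquilinear[of t a 1 b] by simp

lemma T_scale_right: "T a (scale t b) = \<sigma> t * T a b"
  using T_sesquilinear[of 1 a t b] by simp

lemma T_zero_left [simp]: "T 0 b = 0"
  using T_add_left[of 0 0 b] by simp

lemma T_minus_left: "T (- a) b = - T a b"
  using T_add_left[of a "- a" b] by (simp add: eq_neg_iff_add_eq_0 add.commute)

lemma T_minus_right: "T a (- b) = - T a b"
  using arg_cong[OF T_minus_left[of b a], of \<sigma>] by (simp add: T_hermitian)

lemma T_diff_left: "T (a - a') b = T a b - T a' b"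
  using T_add_left[of a "- a'" b] by (simp add: T_minus_left)

lemma T_diff_right: "T a (b - b') = T a b - T a b'"
  using T_add_right[of a b "- b'"] by (simp add: T_minus_right)

lemmas T_simps = T_add_left T_add_right T_diff_left T_diff_right T_minus_left T_minus_right
  T_scale_left T_scale_right

lemma sharp_zero [simp]: "sharp 0 = 0"
  using sharp_scale[of 0 0] by simp

lemma cross_commute: "cross sharp a b = cross sharp b a"
  by (simp add: cross_def add.commute)

lemma cross_zero_right [simp]: "cross sharp a 0 = 0"
  by (simp add: cross_def)

lemma cross_zero_left [simp]: "cross sharp 0 a = 0"
  by (simp add: cross_def)

lemma cross_scale_self: "cross sharp b (scale t b) = scale (2 * \<sigma> t) (sharp b)"
proof -
  have "b + scale t b = scale (1 + t) b" by (simp add: scale_left_distrib)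
  then have "cross sharp b (scale t b) = scale ((1 + \<sigma> t)\<^sup>2 - 1 - (\<sigma> t)\<^sup>2) (sharp b)"
    by (simp add: cross_def sharp_scale scale_left_diff_distrib)
  then show ?thesis by (simp add: power2_eq_square algebra_simps)
qed

lemma cross_self: "cross sharp b b = scale 2 (sharp b)"
  using cross_scale_self[of b 1] by simp

text \<open>
  Expand \<open>N((a + b) + c) = N(a + (b + c))\<close> on both sides: all terms cancel except these two.  The
  identity replaces bilinearity of \<open>\<times>\<close>: whatever is paired with a cross product under \<open>T\<close> can be
  moved into it.
\<close>

lemma T_cross_cyclic: "T c (cross sharp a b) = T a (cross sharp b c)"
proof -
  have "T c (cross sharp a b) - T a (cross sharp b c) = N ((a + b) + c) - N (a + (b + c))"
    unfolding N_add T_simps cross_def by (simp add: algebra_simps)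
  then show ?thesis by (simp add: add.assoc)
qed

lemma T_cross_scale_self: "T b (cross sharp v (scale t b)) = 2 * t * T v (sharp b)"
proof -
  have "T b (cross sharp v (scale t b)) = T v (cross sharp b (scale t b))"
    using T_cross_cyclic[of b v "scale t b"] by (simp add: cross_commute)
  then show ?thesis by (simp add: cross_scale_self T_scale_right)
qed

lemma T_cross_self: "T b (cross sharp v b) = 2 * T v (sharp b)"
  using T_cross_scale_self[of b v 1] by simp

end

locale hermitian_cubic_norm_structure_char_not_2_3 =
  hermitian_cubic_norm_structure scale \<iota> \<sigma> N sharp T
  for scale :: "'k::comm_ring_1 \<Rightarrow> 'j::ab_group_add \<Rightarrow> 'j"
    and \<iota> :: "'f::field \<Rightarrow> 'k" and \<sigma> N sharp T +
  assumes two_nonzero: "(2::'f) \<noteq> 0" and three_nonzero: "(3::'f) \<noteq> 0"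
begin

text \<open>
  The analogue of Euler's identity for the cubic form \<open>N\<close>, obtained from \<open>N(b + b) = 8N(b)\<close>.
\<close>

lemma T_sharp: "T b (sharp b) = 3 * N b"
proof -
  have "scale 2 b = b + b" by (metis one_add_one scale_left_distrib scale_one)
  then have "8 * N b = 2 * N b + 2 * T b (sharp b)"
    using N_add[of b b] N_scale[of 2 b] by (simp add: algebra_simps)
  then have "2 * T b (sharp b) = 2 * (3 * N b)" by (simp add: algebra_simps)
  then show ?thesis using algebra_map_cancel[OF two_nonzero] by simp
qed

lemma T_sharp_left: "T (sharp b) b = 3 * \<sigma> (N b)"
  using arg_cong[OF T_sharp[of b], of \<sigma>] by (simp add: T_hermitian)

text \<open>
  Consequently the skew elements of \<open>K \<oplus> J\<close> are those of \<open>K\<close>, since its involution is the identity on \<open>J\<close>.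
\<close>

lemma neg_eq_self_iff: "(b :: 'j) = - b \<longleftrightarrow> b = 0"
proof
  assume "b = - b"
  then have "scale 2 b = 0"
    by (metis eq_neg_iff_add_eq_0 one_add_one scale_left_distrib scale_one)
  then have "scale (\<iota> (inverse 2)) (scale 2 b) = 0" by simp
  then show "b = 0" using algebra_map_inverse[OF two_nonzero] by simp
qed simp


section \<open>The norm of \<open>K \<oplus> J\<close>\<close>

abbreviation (input) "mul \<equiv> KJ_mul scale \<sigma> sharp T"
abbreviation (input) "smul \<equiv> KJ_smult \<iota> scale"
abbreviation (input) "norm_form s b \<equiv>
  (Nr \<sigma> s - T b b)\<^sup>2 - 4 * T (sharp b) (sharp b) + 4 * Tr \<sigma> (s * N b)"

lemma norm_form_conj: "\<sigma> (norm_form s b) = norm_form s b"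
  by (simp add: Nr_def Tr_def T_hermitian algebra_simps)

text \<open>
  This is where \<open>J\<close>-components drop out: those of \<open>xy\<^sup>*\<close> and \<open>yx\<^sup>*\<close>, where \<open>*\<close> is the involution of
  \<open>K \<oplus> J\<close>, agree because \<open>\<times>\<close> is symmetric.
\<close>

lemma KJ_psi:
  "involution_operations.\<psi> mul (KJ_conj \<sigma>) (s, b) (t, c) =
     (s * \<sigma> t + T b c - \<sigma> (s * \<sigma> t + T b c), 0)"
  by (simp add: involution_operations.\<psi>_def KJ_mul_def KJ_conj_def T_hermitian
      cross_commute[of b c] algebra_simps)

text \<open>
  The \<open>J\<close>-component of \<open>U\<^sub>x(s\<^sub>0x)\<close> is left unevaluated; what matters is its pairing with \<open>b\<close>, where
  \<open>T_cross_scale_self\<close> removes the crosses with \<open>v\<close> and \<open>w\<close> below.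
\<close>

lemma KJ_U_skew:
  assumes p: "\<sigma> p = - p"
  obtains c where
    "involution_operations.U smul mul (KJ_conj \<sigma>) (s, b) (mul (p, 0) (s, b)) =
       (3 * p * (s * T b b - s * Nr \<sigma> s - 2 * \<sigma> (N b)), c)"
    and "T b c = 3 * p * ((T b b)\<^sup>2 - Nr \<sigma> s * T b b + 6 * s * N b - 4 * T (sharp b) (sharp b))"
proof -
  define v where "v = scale (2 * p * s) b - scale (2 * p) (sharp b)"
  define w where "w = scale (2 * s) b + scale 2 (sharp b)"
  define A where "A = - p * (Nr \<sigma> s + T b b)"
  define B where "B = Nr \<sigma> s + T b b"
  define d where "d = scale A b + scale (\<sigma> s) v + cross sharp v b"
  define e where "e = scale (B * p) b + scale (- p * \<sigma> s) w + cross sharp w (scale p b)"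
  note defs = KJ_mul_def KJ_conj_def KJ_smult_def Nr_def T_simps T_sharp T_sharp_left p
  have y: "mul (p, 0) (s, b) = (p * s, scale p b)"
    by (simp add: KJ_mul_def)
  have xy: "mul (s, b) (KJ_conj \<sigma> (p * s, scale p b)) = (A, v)"
    by (simp add: defs A_def v_def cross_scale_self scale_left_distrib[symmetric] algebra_simps)
  have xx: "mul (s, b) (KJ_conj \<sigma> (s, b)) = (B, w)"
    by (simp add: defs B_def w_def cross_self scale_left_distrib[symmetric])
  have xyx: "mul (A, v) (s, b) = (A * s + T v b, d)"
    by (simp add: KJ_mul_def d_def)
  have xxy: "mul (B, w) (p * s, scale p b) = (B * p * s + T w (scale p b), e)"
    by (simp add: KJ_mul_def e_def p mult.assoc)
  have "involution_operations.U smul mul (KJ_conj \<sigma>) (s, b) (mul (p, 0) (s, b)) =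
      (2 * (A * s + T v b) - (B * p * s + T w (scale p b)), scale 2 d - e)"
    unfolding involution_operations.U_def y xy xx xyx xxy by (simp add: KJ_smult_def)
  moreover have "2 * (A * s + T v b) - (B * p * s + T w (scale p b)) =
      3 * p * (s * T b b - s * Nr \<sigma> s - 2 * \<sigma> (N b))"
    by (simp add: A_def B_def v_def w_def T_simps T_sharp_left p algebra_simps)
  moreover have "T b (scale 2 d - e) =
      3 * p * ((T b b)\<^sup>2 - Nr \<sigma> s * T b b + 6 * s * N b - 4 * T (sharp b) (sharp b))"
    by (simp add: d_def e_def A_def B_def v_def w_def T_simps T_cross_self T_cross_scale_self
        T_sharp T_hermitian Nr_def p power2_eq_square algebra_simps)
  ultimately show ?thesis using that by metis
qed

lemma psi_U_skew:
  assumes p: "\<sigma> p = - p"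
  shows "involution_operations.\<psi> mul (KJ_conj \<sigma>) (s, b)
      (involution_operations.U smul mul (KJ_conj \<sigma>) (s, b) (mul (p, 0) (s, b))) =
    (6 * p * norm_form s b, 0)"
proof -
  obtain c where U: "involution_operations.U smul mul (KJ_conj \<sigma>) (s, b) (mul (p, 0) (s, b)) =
       (3 * p * (s * T b b - s * Nr \<sigma> s - 2 * \<sigma> (N b)), c)"
    and c: "T b c = 3 * p * ((T b b)\<^sup>2 - Nr \<sigma> s * T b b + 6 * s * N b - 4 * T (sharp b) (sharp b))"
    by (rule KJ_U_skew[OF p])
  show ?thesis
    unfolding U KJ_psi c
    by (simp add: p T_hermitian Nr_def Tr_def power2_eq_square algebra_simps)
qed

lemma KJ_skew_unit:
  obtains p where "involution_operations.skew_unit (KJ_conj \<sigma>) = (p, 0 :: 'j)"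
    and "p \<noteq> 0" and "\<sigma> p = - p"
proof -
  let ?skew = "involution_operations.skew (KJ_conj \<sigma>) :: ('k \<times> 'j) set"
  obtain q where "q \<noteq> 0" "\<sigma> q = - q" using skew_exists by blast
  then have "(q, 0) \<in> ?skew \<and> (q, 0 :: 'j) \<noteq> 0"
    by (simp add: involution_operations.skew_def KJ_conj_def zero_prod_def)
  then have u: "involution_operations.skew_unit (KJ_conj \<sigma>) \<in> ?skew
      \<and> involution_operations.skew_unit (KJ_conj \<sigma>) \<noteq> (0 :: 'k \<times> 'j)"
    unfolding involution_operations.skew_unit_def by (rule someI)
  obtain p :: 'k and d :: 'j where pd: "involution_operations.skew_unit (KJ_conj \<sigma>) = (p, d)"
    by fastforce
  then have "d = - d" and p: "\<sigma> p = - p" and "(p, d) \<noteq> 0"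
    using u by (auto simp: involution_operations.skew_def KJ_conj_def)
  then have "d = 0" "p \<noteq> 0" using neg_eq_self_iff by (auto simp: zero_prod_def)
  then show ?thesis using that pd p by blast
qed

text \<open>
  The scalar \<open>c\<close> below exists because the norm form is fixed by \<open>\<sigma>\<close>; \<open>\<psi>(x, U\<^sub>x(s\<^sub>0x))s\<^sub>0 = 6\<mu>c\<close> then
  shows both that the coefficient defining the norm is \<open>c\<close> and that it is independent of \<open>s\<^sub>0\<close>.
\<close>

lemma KJ_norm_eq: "\<iota> (KJ_norm \<iota> \<sigma> scale sharp T (s, b)) = norm_form s b"
proof -
  obtain p where u: "involution_operations.skew_unit (KJ_conj \<sigma>) = (p, 0 :: 'j)"
    and p: "p \<noteq> 0" "\<sigma> p = - p"
    by (rule KJ_skew_unit)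
  obtain \<mu> where \<mu>: "\<mu> \<noteq> 0" "p * p = \<iota> \<mu>" using skew_square_scalar[OF p] by blast
  have smul_one: "smul c KJ_one = (\<iota> c, 0)" for c
    by (simp add: KJ_smult_def KJ_one_def)
  have square: "involution_operations.skew_square smul mul KJ_one (KJ_conj \<sigma>) = \<mu>"
    unfolding involution_operations.skew_square_def u smul_one
    by (rule the_equality) (simp_all add: KJ_mul_def \<mu>)
  obtain c where c: "norm_form s b = \<iota> c"
    using norm_form_conj fixed_iff by blast
  have six: "(6::'f) * \<mu> \<noteq> 0"
    using two_nonzero three_nonzero \<mu>(1) mult_eq_0_iff[of "2::'f" 3] by simp
  have "smul (1 / (6 * \<mu>)) (mul (6 * p * \<iota> c, 0) (p, 0)) = smul c KJ_one"
  proof -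
    have "\<iota> (1 / (6 * \<mu>)) * (6 * p * \<iota> c * p) = \<iota> (1 / (6 * \<mu>)) * \<iota> (6 * \<mu>) * \<iota> c"
      by (simp add: \<mu>(2)[symmetric] mult_ac)
    also have "\<dots> = \<iota> c"
      using algebra_map_inverse[OF six] by (simp add: inverse_eq_divide)
    finally show ?thesis
      unfolding smul_one by (simp add: KJ_mul_def KJ_smult_def)
  qed
  then have "KJ_norm \<iota> \<sigma> scale sharp T (s, b) = (THE a. smul a KJ_one = smul c KJ_one)"
    unfolding KJ_norm_def involution_operations.norm_def square
    unfolding u psi_U_skew[OF p(2)] c by simp
  also have "\<dots> = c"
    by (rule the_equality) (simp_all add: smul_one)
  finally show ?thesis using c by simp
qed

end

lemma of_nat_prime_nonzero:
  assumes "CHAR('f::field) \<noteq> n" "prime n"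
  shows "(of_nat n :: 'f) \<noteq> 0"
  using assms CHAR_not_1' by (auto simp: of_nat_eq_0_iff_char_dvd prime_nat_iff)

theorem proposition4p11:
  fixes \<iota> :: "'f::field \<Rightarrow> 'k::comm_ring_1"
    and \<sigma> :: "'k \<Rightarrow> 'k"
    and scale :: "'k \<Rightarrow> 'j::ab_group_add \<Rightarrow> 'j"
    and N :: "'j \<Rightarrow> 'k" and sharp :: "'j \<Rightarrow> 'j" and T :: "'j \<Rightarrow> 'j \<Rightarrow> 'k"
    and s :: 'k and b :: 'j
  assumes "CHAR('f) \<noteq> 2" and "CHAR('f) \<noteq> 3"
    and "hermitian_cubic_norm_structure scale \<iota> \<sigma> N sharp T"
  shows "\<iota> (KJ_norm \<iota> \<sigma> scale sharp T (s, b)) =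
    (Nr \<sigma> s - T b b)\<^sup>2 - 4 * T (sharp b) (sharp b) + 4 * Tr \<sigma> (s * N b)"
proof -
  interpret hermitian_cubic_norm_structure scale \<iota> \<sigma> N sharp T
    by (fact assms(3))
  have "(2::'f) \<noteq> 0" "(3::'f) \<noteq> 0"
    using of_nat_prime_nonzero[OF assms(1)] of_nat_prime_nonzero[OF assms(2)] by simp_all
  then interpret hermitian_cubic_norm_structure_char_not_2_3 scale \<iota> \<sigma> N sharp T
    by unfold_locales
  show ?thesis by (rule KJ_norm_eq)
qed

end
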